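(* Let $K$ be a field, $I$ a set, and let $E\subset K^I$ be a linear subspace containing the constant functions which separates points in $I$ and is topology-inducing. If $I$ is finite, then $E=K^I$. Consequently, for general $I$, for any finite subset $I'\subset I$, every function $I'\to K$ is the restriction to $I'$ of some member of $E$.
   Context: $K^I$ is the $K$-vector space of all functions $I\to K$. $E$ separates points in $I$ if for any distinct $t_1,t_2\in I$ and any $a_1,a_2\in K$ there is a $\xi\in E$ with $\xi(t_1)=a_1$ and $\xi(t_2)=a_2$. A subset $S\subset I$ is $E$-closed if for every $t\in I\setminus S$ there is a $\xi\in E$ vanishing on $S$ with $\xi(t)\neq 0$. A linear subspace $E\subset K^I$ containing the constants is topology-inducing if the union of any two $E$-closed subsets of $I$ is $E$-closed (so that the $E$-closed sets are the closed sets of a topology on $I$). *)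

theory Defs
  imports "HOL-Library.FuncSet"
begin

text \<open>
  The index set \<open>I\<close> is an arbitrary, possibly empty or infinite, carrier set.  A function \<open>I \<rightarrow> K\<close>
  is represented by its unique extensional representative, which takes the value \<open>undefined\<close>
  outside \<open>I\<close>; hence equality of members of \<open>K\<^sup>I\<close> is equality of functions on \<open>I\<close>.
\<close>

definition fun_space :: "'i set \<Rightarrow> ('i \<Rightarrow> 'k::field) set" where
  "fun_space I = (I \<rightarrow>\<^sub>E UNIV)"

text \<open>The vector space operations are pointwise on \<open>I\<close>, re-normalised outside \<open>I\<close>.\<close>

definition linear_subspace :: "'i set \<Rightarrow> ('i \<Rightarrow> 'k::field) set \<Rightarrow> bool" where
  "linear_subspace I E \<longleftrightarrow>
     E \<subseteq> fun_space I \<and>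
     (\<lambda>t\<in>I. 0) \<in> E \<and>
     (\<forall>\<xi>\<in>E. \<forall>\<eta>\<in>E. (\<lambda>t\<in>I. \<xi> t + \<eta> t) \<in> E) \<and>
     (\<forall>c. \<forall>\<xi>\<in>E. (\<lambda>t\<in>I. c * \<xi> t) \<in> E)"

definition contains_constants :: "'i set \<Rightarrow> ('i \<Rightarrow> 'k::field) set \<Rightarrow> bool" where
  "contains_constants I E \<longleftrightarrow> (\<forall>c. (\<lambda>t\<in>I. c) \<in> E)"

definition separates_points :: "'i set \<Rightarrow> ('i \<Rightarrow> 'k::field) set \<Rightarrow> bool" where
  "separates_points I E \<longleftrightarrow>
     (\<forall>t1\<in>I. \<forall>t2\<in>I. t1 \<noteq> t2 \<longrightarrow> (\<forall>a1 a2. \<exists>\<xi>\<in>E. \<xi> t1 = a1 \<and> \<xi> t2 = a2))"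

definition E_closed :: "'i set \<Rightarrow> ('i \<Rightarrow> 'k::field) set \<Rightarrow> 'i set \<Rightarrow> bool" where
  "E_closed I E S \<longleftrightarrow>
     S \<subseteq> I \<and> (\<forall>t\<in>I - S. \<exists>\<xi>\<in>E. (\<forall>s\<in>S. \<xi> s = 0) \<and> \<xi> t \<noteq> 0)"

definition topology_inducing :: "'i set \<Rightarrow> ('i \<Rightarrow> 'k::field) set \<Rightarrow> bool" where
  "topology_inducing I E \<longleftrightarrow>
     (\<forall>S T. E_closed I E S \<longrightarrow> E_closed I E T \<longrightarrow> E_closed I E (S \<union> T))"

end

theory Submission
  imports Defs
begin

text \<open>
  Points are \<open>E\<close>-closed because \<open>E\<close> separates points, so finite sets are \<open>E\<close>-closed because \<open>E\<close> is
  topology-inducing. Hence, for a finite set \<open>F\<close> and a point \<open>x\<close> outside it, some member of \<open>E\<close>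
  vanishes on \<open>F\<close> but not at \<open>x\<close>; adding a multiple of it corrects the value at \<open>x\<close> of an
  interpolant without disturbing its values on \<open>F\<close>.
\<close>

text \<open>The constant 1 vanishes nowhere on \<open>I\<close>. As \<open>topology_inducing\<close>
  speaks only of binary unions, the empty set needs this separate argument to start the induction
  over finite sets.\<close>

lemma E_closed_empty:
  assumes "contains_constants I E"
  shows "E_closed I E {}"
proof -
  have "(\<lambda>t\<in>I. 1) \<in> E"
    using assms by (simp add: contains_constants_def)
  then show ?thesis
    unfolding E_closed_def by (auto intro!: bexI[of _ "\<lambda>t\<in>I. 1"])
qed

lemma E_closed_singleton:
  fixes E :: "('i \<Rightarrow> 'k::field) set"
  assumes "separates_points I E" and "s \<in> I"
  shows "E_closed I E {s}"
  unfolding E_closed_def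
proof (intro conjI ballI)
  fix t assume "t \<in> I - {s}"
  then obtain \<xi> where "\<xi> \<in> E" "\<xi> s = 0" "\<xi> t = 1"
    using assms unfolding separates_points_def by blast
  then show "\<exists>\<xi>\<in>E. (\<forall>s\<in>{s}. \<xi> s = 0) \<and> \<xi> t \<noteq> 0"
    by auto
qed (use assms in simp)

lemma E_closed_finite:
  assumes "contains_constants I E" and "separates_points I E" and "topology_inducing I E"
    and "finite F" and "F \<subseteq> I"
  shows "E_closed I E F"
  using assms(4,5)
proof (induction F)
  case empty
  show ?case using assms(1) by (rule E_closed_empty)
next
  case (insert x F)
  then have "E_closed I E ({x} \<union> F)"
    using assms(3) E_closed_singleton[OF assms(2), of x] unfolding topology_inducing_def by blast
  then show ?case by simp
qed

text \<open>Only the values of \<open>g\<close> on \<open>F\<close> matter, so one fixed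
  \<open>g\<close> serves throughout the induction on \<open>F\<close>.\<close>

lemma finite_interpolation:
  assumes "linear_subspace I E" and "contains_constants I E" and "separates_points I E"
    and "topology_inducing I E" and "finite F" and "F \<subseteq> I"
  shows "\<exists>\<xi>\<in>E. \<forall>t\<in>F. \<xi> t = g t"
  using assms(5,6)
proof (induction F)
  case empty
  then show ?case using assms(1) unfolding linear_subspace_def by blast
next
  case (insert x F)
  then obtain \<xi> where \<xi>: "\<xi> \<in> E" "\<forall>t\<in>F. \<xi> t = g t"
    by auto
  have "E_closed I E F"
    using E_closed_finite[OF assms(2-4)] insert by simp
  then obtain \<eta> where \<eta>: "\<eta> \<in> E" "\<forall>t\<in>F. \<eta> t = 0" "\<eta> x \<noteq> 0"
    using insert unfolding E_closed_def by blast
  \<comment> \<open>Solves \<open>\<xi> x + c * \<eta> x = g x\<close> for \<open>c\<close>.\<close>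
  define c where "c = (g x - \<xi> x) / \<eta> x"
  define \<eta>' where "\<eta>' = (\<lambda>t\<in>I. c * \<eta> t)"
  have "\<eta>' \<in> E"
    using assms(1) \<eta>(1) unfolding linear_subspace_def \<eta>'_def by blast
  then have "(\<lambda>t\<in>I. \<xi> t + \<eta>' t) \<in> E"
    using assms(1) \<xi>(1) unfolding linear_subspace_def by blast
  \<comment> \<open>All these points lie in \<open>I\<close>, so the value \<open>undefined\<close>
    taken outside \<open>I\<close> never enters.\<close>
  moreover have "\<forall>t\<in>insert x F. (\<lambda>t\<in>I. \<xi> t + \<eta>' t) t = g t"
    using insert \<xi>(2) \<eta>(2,3) by (auto simp: \<eta>'_def c_def)
  ultimately show ?case by blast
qed

theorem theorem2:
  fixes I :: "'i set" and E :: "('i \<Rightarrow> 'k::field) set"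
  assumes "linear_subspace I E"
    and "contains_constants I E"
    and "separates_points I E"
    and "topology_inducing I E"
  shows "(finite I \<longrightarrow> E = fun_space I) \<and>
         (\<forall>I'. finite I' \<and> I' \<subseteq> I \<longrightarrow> (\<forall>g\<in>fun_space I'. \<exists>\<xi>\<in>E. restrict \<xi> I' = g))"
proof -
  have sub: "E \<subseteq> fun_space I"
    using assms(1) by (simp add: linear_subspace_def)
  have ext: "\<exists>\<xi>\<in>E. restrict \<xi> I' = g"
    if F: "finite I'" "I' \<subseteq> I" and g: "g \<in> fun_space I'" for I' g
  proof -
    obtain \<xi> where "\<xi> \<in> E" "\<forall>t\<in>I'. \<xi> t = g t"
      using finite_interpolation[OF assms F, of g] by (elim bexE)
    \<comment> \<open>Both sides are \<open>undefined\<close> outside \<open>I'\<close>, so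
      agreement on \<open>I'\<close> gives equality.\<close>
    moreover from this have "restrict \<xi> I' = g"
      using g unfolding fun_space_def by (metis PiE_restrict restrict_ext)
    ultimately show ?thesis by (intro bexI)
  qed
  \<comment> \<open>This is the case \<open>I' = I\<close>: members of \<open>E\<close> are
    extensional on \<open>I\<close>, so restricting the interpolant to \<open>I\<close> leaves it
    unchanged and \<open>g\<close> is the interpolant itself.\<close>
  have "g \<in> E" if I: "finite I" and g: "g \<in> fun_space I" for g
  proof -
    obtain \<xi> where \<xi>: "\<xi> \<in> E" "restrict \<xi> I = g"
      using ext[OF I subset_refl g] by (elim bexE)
    moreover have "restrict \<xi> I = \<xi>"
      using sub \<xi>(1) by (auto simp: fun_space_def PiE_def extensional_restrict)
    ultimately show ?thesis by simp
  qed
  then show ?thesis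
    using sub ext by (intro conjI impI allI ballI subset_antisym) auto
qed

end
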